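(* Let $c\in\mathbb R$ and let $\lambda$ be a real-valued continuous function with $$\lambda(t)=c\sqrt t+o(\sqrt t),\qquad t\to0,$$ which is the driving function in the chordal Löwner differential equation $$\frac{df(z,t)}{dt}=\frac{2}{f(z,t)-\lambda(t)},\qquad f(z,0)\equiv z,\qquad t\ge0.$$ Then the singular solutions $f_1(0,t)$ and $f_2(0,t)$ of this equation satisfy $$\lim_{t\to0}\frac{f_1(0,t)}{\sqrt t}=\frac{c+\sqrt{c^2+16}}{2},\qquad \lim_{t\to0}\frac{f_2(0,t)}{\sqrt t}=\frac{c-\sqrt{c^2+16}}{2}.$$
   Context: Note that $\lambda(0)=0$. The singular solutions $f_1(0,t)$, $f_2(0,t)$ are the two real-valued solutions of the equation that pass through its singular point $(0,0)$: they are continuous functions on an interval $[0,T]$, $T>0$, with $f_1(0,0)=f_2(0,0)=0$, they satisfy $$\frac{df_k(0,t)}{dt}=\frac{2}{f_k(0,t)-\lambda(t)},\qquad 0<t\le T,\quad k=1,2,$$ and $$f_2(0,t)<\lambda(t)<f_1(0,t),\qquad 0<t\le T.$$ (When the equation generates maps $f(\cdot,t)$ of $\mathbb H\setminus\gamma[0,t]$ onto the upper half-plane $\mathbb H$ for a simple curve $\gamma$ in $\mathbb H\cup\{0\}$ with $\gamma(0)=0$, the segment $[f_2(0,t),f_1(0,t)]$ is the image of the slit $\gamma[0,t]$ under the extended map $f(\cdot,t)$.) All limits are as $t\to0$ with $t>0$. *)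

theory Defs
  imports Complex_Main "HOL-Library.Landau_Symbols"
begin

text \<open>
  The chordal Loewner differential equation with driving function \<open>\<xi>\<close> along a real-valued
  trajectory \<open>f\<close> on \<open>(0, T]\<close>; at the endpoint \<open>T\<close> the derivative is one-sided. The condition
  \<open>f t \<noteq> \<xi> t\<close> excludes the totalised division \<open>2 / 0 = 0\<close>. The equation is not imposed
  at time \<open>0\<close>, since the trajectories of interest start at the singular point, where
  \<open>f 0 = \<xi> 0\<close>.
\<close>

definition loewner_ode :: "(real \<Rightarrow> real) \<Rightarrow> real \<Rightarrow> (real \<Rightarrow> real) \<Rightarrow> bool" where
  "loewner_ode \<xi> T f \<longleftrightarrow>
     (\<forall>t\<in>{0<..T}. f t \<noteq> \<xi> t \<and>
        (f has_real_derivative 2 / (f t - \<xi> t)) (at t within {0..T}))"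

text \<open>
  \<open>f1\<close> and \<open>f2\<close> are the trajectories \<open>f\<^sub>1(0, \<cdot>)\<close> and \<open>f\<^sub>2(0, \<cdot>)\<close> through the singular
  point \<open>(0, 0)\<close>, above and below the driving function respectively.
\<close>

definition singular_solutions ::
    "(real \<Rightarrow> real) \<Rightarrow> real \<Rightarrow> (real \<Rightarrow> real) \<Rightarrow> (real \<Rightarrow> real) \<Rightarrow> bool" where
  "singular_solutions \<xi> T f1 f2 \<longleftrightarrow>
     continuous_on {0..T} f1 \<and> continuous_on {0..T} f2 \<and>
     f1 0 = 0 \<and> f2 0 = 0 \<and>
     loewner_ode \<xi> T f1 \<and> loewner_ode \<xi> T f2 \<and>
     (\<forall>t\<in>{0<..T}. f2 t < \<xi> t \<and> \<xi> t < f1 t)"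

end

theory Submission
  imports Defs
begin

text \<open>
  Write \<open>A\<close> for the positive root of \<open>x * (x - c) = 4\<close>. If \<open>B > A\<close>, then \<open>f t - B * sqrt t\<close> has
  negative derivative wherever it is positive and \<open>t\<close> is small; since it starts from \<open>0\<close>, it can
  never become positive. If \<open>0 < B < A\<close>, the same holds with all signs reversed. Hence
  \<open>f t / sqrt t\<close> tends to \<open>A\<close>. The trajectory below the driving function is reduced to the one
  above by the reflection \<open>x \<mapsto> - x\<close>.
\<close>

text \<open>A positive value would give a positive maximum at some \<open>m > 0\<close>, where the
  negative derivative forces larger values just to the left of \<open>m\<close>. Only the left side
  matters, so \<open>m = s\<close> needs no separate treatment.\<close>

lemma nonpos_if_deriv_neg_where_pos:
  fixes \<phi> \<phi>' :: "real \<Rightarrow> real"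
  assumes "0 \<le> s" and cont: "continuous_on {0..s} \<phi>" and "\<phi> 0 \<le> 0"
    and deriv: "\<And>t. 0 < t \<Longrightarrow> t \<le> s \<Longrightarrow> (\<phi> has_real_derivative \<phi>' t) (at t within {0..s})"
    and neg: "\<And>t. 0 < t \<Longrightarrow> t \<le> s \<Longrightarrow> 0 < \<phi> t \<Longrightarrow> \<phi>' t < 0"
  shows "\<phi> s \<le> 0"
proof (rule ccontr)
  assume "\<not> \<phi> s \<le> 0"
  obtain m where m: "m \<in> {0..s}" "\<And>t. t \<in> {0..s} \<Longrightarrow> \<phi> t \<le> \<phi> m"
    using continuous_attains_sup[OF _ _ cont] \<open>0 \<le> s\<close> by auto
  have "0 < \<phi> m" using m(2)[of s] \<open>\<not> \<phi> s \<le> 0\<close> \<open>0 \<le> s\<close> by simp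
  then have "0 < m" using \<open>\<phi> 0 \<le> 0\<close> m(1) by (cases "m = 0") auto
  have "(\<phi> has_real_derivative \<phi>' m) (at m within {0..s})" "\<phi>' m < 0"
    using deriv neg m(1) \<open>0 < m\<close> \<open>0 < \<phi> m\<close> by auto
  then obtain d where "d > 0" and d: "\<And>h. 0 < h \<Longrightarrow> m - h \<in> {0..s} \<Longrightarrow> h < d \<Longrightarrow> \<phi> m < \<phi> (m - h)"
    using has_real_derivative_neg_dec_left by blast
  \<comment> \<open>The bound by \<open>m\<close> keeps \<open>m - h\<close> nonnegative, and
    \<open>d / 2\<close> keeps \<open>h\<close> strictly below \<open>d\<close>.\<close>
  define h where "h = min m (d / 2)"
  have "0 < h" "h < d" "m - h \<in> {0..s}"
    using \<open>0 < m\<close> \<open>d > 0\<close> m(1) by (auto simp: h_def)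
  then show False using d[of h] m(2)[of "m - h"] by simp
qed

text \<open>The comparison runs over all of \<open>{0<..s}\<close>, so the asymptotic hypothesis is
  turned into a bound on an explicit interval.\<close>

lemma smallo_sqrt_bound:
  assumes "(\<lambda>t. \<xi> t - c * sqrt t) \<in> o[at_right 0](\<lambda>t. sqrt t)" and "\<delta> > 0"
  obtains b where "b > 0" and "\<And>t. 0 < t \<Longrightarrow> t < b \<Longrightarrow> \<bar>\<xi> t - c * sqrt t\<bar> \<le> \<delta> * sqrt t"
proof -
  have "eventually (\<lambda>t. \<bar>\<xi> t - c * sqrt t\<bar> \<le> \<delta> * sqrt t) (at_right 0)"
    using landau_o.smallD[OF assms] eventually_at_right_less[of 0]
    by eventually_elim simp
  then show ?thesis using that by (auto simp: eventually_at_right_field)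
qed

text \<open>With \<open>f t - \<xi> t\<close> replaced by \<open>k * sqrt t\<close>, the Loewner
  slope and the slope of \<open>B * sqrt t\<close> both scale like \<open>1 / sqrt t\<close>, so
  comparing them is a condition on constants.\<close>

lemma slope_less_sqrt_slope_iff:
  fixes k B t :: real
  assumes "k > 0" "t > 0"
  shows "2 / (k * sqrt t) < B / (2 * sqrt t) \<longleftrightarrow> 4 < B * k"
    and "B / (2 * sqrt t) < 2 / (k * sqrt t) \<longleftrightarrow> B * k < 4"
  using assms by (auto simp: field_simps)

context
  fixes c T :: real and \<xi> f :: "real \<Rightarrow> real"
  assumes driving: "(\<lambda>t. \<xi> t - c * sqrt t) \<in> o[at_right 0](\<lambda>t. sqrt t)"
    and T: "T > 0"
    and cont: "continuous_on {0..T} f" and f0: "f 0 = 0"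
    and ode: "loewner_ode \<xi> T f"
    and above: "\<And>t. t \<in> {0<..T} \<Longrightarrow> \<xi> t < f t"
begin

lemma deriv_minus_sqrt:
  assumes "0 < t" "t \<le> s" "s \<le> T"
  shows "((\<lambda>t. f t - B * sqrt t) has_real_derivative
           2 / (f t - \<xi> t) - B / (2 * sqrt t)) (at t within {0..s})"
proof -
  have "(f has_real_derivative 2 / (f t - \<xi> t)) (at t within {0..s})"
    using ode assms unfolding loewner_ode_def
    by (intro has_field_derivative_subset[of f _ t "{0..T}" "{0..s}"]) auto
  moreover have "((\<lambda>t. B * sqrt t) has_real_derivative B / (2 * sqrt t)) (at t within {0..s})"
    using assms(1) by (auto intro!: derivative_eq_intros simp: divide_simps)
  ultimately show ?thesis by (rule DERIV_diff)
qed

text \<open>Where \<open>f t > B * sqrt t\<close>, the gap \<open>f t - \<xi> t\<close> is at least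
  \<open>(B - c - \<delta>) * sqrt t\<close>, which makes \<open>f\<close> grow more slowly than
  \<open>B * sqrt t\<close>.\<close>

lemma eventually_le_sqrt:
  assumes "B > 0" and "B * (B - c) > 4"
  shows "eventually (\<lambda>t. f t \<le> B * sqrt t) (at_right 0)"
proof -
  \<comment> \<open>Perturbing \<open>c\<close> by \<open>\<delta>\<close> uses up only half of the
    excess of \<open>B * (B - c)\<close> over 4, so the inequality stays strict.\<close>
  define \<delta> where "\<delta> = (B * (B - c) - 4) / (2 * B)"
  have "\<delta> > 0" using assms by (simp add: \<delta>_def)
  have "B * \<delta> = (B * (B - c) - 4) / 2" using assms(1) by (simp add: \<delta>_def)
  then have large: "B * (B - c - \<delta>) > 4" using assms by (simp add: algebra_simps)
  then have gap: "B - c - \<delta> > 0" using assms(1) by (smt (verit) mult_nonneg_nonpos)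
  obtain b where "b > 0" and b: "\<And>t. 0 < t \<Longrightarrow> t < b \<Longrightarrow> \<bar>\<xi> t - c * sqrt t\<bar> \<le> \<delta> * sqrt t"
    using smallo_sqrt_bound[OF driving \<open>\<delta> > 0\<close>] by blast
  have "f s \<le> B * sqrt s" if s: "0 < s" "s < b" "s < T" for s
  proof -
    have "f s - B * sqrt s \<le> 0"
    proof (rule nonpos_if_deriv_neg_where_pos[where s = s
          and \<phi> = "\<lambda>t. f t - B * sqrt t"
          and \<phi>' = "\<lambda>t. 2 / (f t - \<xi> t) - B / (2 * sqrt t)"])
      show "continuous_on {0..s} (\<lambda>t. f t - B * sqrt t)"
        using s by (intro continuous_intros continuous_on_subset[OF cont]) auto
      fix t assume t: "0 < t" "t \<le> s"
      show "((\<lambda>t. f t - B * sqrt t) has_real_derivative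
              2 / (f t - \<xi> t) - B / (2 * sqrt t)) (at t within {0..s})"
        using t s by (intro deriv_minus_sqrt) auto
      assume "0 < f t - B * sqrt t"
      then have "(B - c - \<delta>) * sqrt t \<le> f t - \<xi> t"
        using b[of t] t s by (simp add: algebra_simps)
      then have "2 / (f t - \<xi> t) \<le> 2 / ((B - c - \<delta>) * sqrt t)"
        using gap t s above[of t] by (intro divide_left_mono mult_pos_pos) auto
      also have "\<dots> < B / (2 * sqrt t)"
        using gap t(1) large by (simp only: slope_less_sqrt_slope_iff)
      finally show "2 / (f t - \<xi> t) - B / (2 * sqrt t) < 0" by simp
    qed (use s f0 in auto)
    then show ?thesis by simp
  qed
  then show ?thesis
    using \<open>b > 0\<close> T by (auto simp: eventually_at_right_field intro!: exI[of _ "min b T"])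
qed

text \<open>Where \<open>f t < B * sqrt t\<close>, the gap \<open>f t - \<xi> t\<close> is at most
  \<open>(B - c + \<delta>) * sqrt t\<close>, which makes \<open>f\<close> grow faster than
  \<open>B * sqrt t\<close>.\<close>

lemma eventually_ge_sqrt:
  assumes "B > 0" and "B * (B - c) < 4"
  shows "eventually (\<lambda>t. B * sqrt t \<le> f t) (at_right 0)"
proof -
  define \<delta> where "\<delta> = (4 - B * (B - c)) / (2 * B)"
  have "\<delta> > 0" using assms by (simp add: \<delta>_def)
  have "B * \<delta> = (4 - B * (B - c)) / 2" using assms(1) by (simp add: \<delta>_def)
  then have small: "B * (B - c + \<delta>) < 4" using assms by (simp add: algebra_simps)
  obtain b where "b > 0" and b: "\<And>t. 0 < t \<Longrightarrow> t < b \<Longrightarrow> \<bar>\<xi> t - c * sqrt t\<bar> \<le> \<delta> * sqrt t"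
    using smallo_sqrt_bound[OF driving \<open>\<delta> > 0\<close>] by blast
  have "B * sqrt s \<le> f s" if s: "0 < s" "s < b" "s < T" for s
  proof -
    have "- (f s - B * sqrt s) \<le> 0"
    proof (rule nonpos_if_deriv_neg_where_pos[where s = s
          and \<phi> = "\<lambda>t. - (f t - B * sqrt t)"
          and \<phi>' = "\<lambda>t. - (2 / (f t - \<xi> t) - B / (2 * sqrt t))"])
      show "continuous_on {0..s} (\<lambda>t. - (f t - B * sqrt t))"
        using s by (intro continuous_intros continuous_on_subset[OF cont]) auto
      fix t assume t: "0 < t" "t \<le> s"
      show "((\<lambda>t. - (f t - B * sqrt t)) has_real_derivative
              - (2 / (f t - \<xi> t) - B / (2 * sqrt t))) (at t within {0..s})"
        using t s by (intro DERIV_minus deriv_minus_sqrt) auto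
      assume "0 < - (f t - B * sqrt t)"
      then have le: "f t - \<xi> t \<le> (B - c + \<delta>) * sqrt t"
        using b[of t] t s by (simp add: algebra_simps)
      \<comment> \<open>An upper bound on \<open>B * (B - c + \<delta>)\<close> says nothing about
        the sign of the second factor. Its positivity comes from the trajectory lying above the
        driving function at this \<open>t\<close>.\<close>
      have pos: "0 < f t - \<xi> t" using above[of t] t s by simp
      with le have gap: "B - c + \<delta> > 0"
        using t by (smt (verit) mult_nonpos_nonneg real_sqrt_ge_zero)
      have "B / (2 * sqrt t) < 2 / ((B - c + \<delta>) * sqrt t)"
        using gap t(1) small by (simp only: slope_less_sqrt_slope_iff)
      also have "\<dots> \<le> 2 / (f t - \<xi> t)"
        using le pos by (intro divide_left_mono) auto
      finally show "- (2 / (f t - \<xi> t) - B / (2 * sqrt t)) < 0" by simp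
    qed (use s f0 in auto)
    then show ?thesis by simp
  qed
  then show ?thesis
    using \<open>b > 0\<close> T by (auto simp: eventually_at_right_field intro!: exI[of _ "min b T"])
qed

lemma upper_solution_asymp:
  "((\<lambda>t. f t / sqrt t) \<longlongrightarrow> (c + sqrt (c\<^sup>2 + 16)) / 2) (at_right 0)"
proof -
  define A where "A = (c + sqrt (c\<^sup>2 + 16)) / 2"
  define A' where "A' = (c - sqrt (c\<^sup>2 + 16)) / 2"
  have "\<bar>c\<bar> < sqrt (c\<^sup>2 + 16)" by (rule real_less_rsqrt) simp
  then have "A > 0" "A' < 0" by (auto simp: A_def A'_def)
  have "(sqrt (c\<^sup>2 + 16))\<^sup>2 = c\<^sup>2 + 16" by simp
  \<comment> \<open>Since \<open>A' < 0 < A\<close>, the sign at a positive \<open>B\<close> depends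
    only on the side of \<open>A\<close> on which \<open>B\<close> lies.\<close>
  then have factor: "x * (x - c) - 4 = (x - A) * (x - A')" for x
    by (simp add: A_def A'_def field_simps power2_eq_square)
  have "((\<lambda>t. f t / sqrt t) \<longlongrightarrow> A) (at_right 0)"
  proof (rule order_tendstoI)
    fix a assume "a < A"
    \<comment> \<open>The lower bound requires \<open>B > 0\<close>, whereas \<open>a\<close> may be
      negative.\<close>
    then obtain B where B: "max a 0 < B" "B < A" using dense[of "max a 0" A] \<open>A > 0\<close> by auto
    have "B * (B - c) - 4 < 0"
      unfolding factor using B \<open>A' < 0\<close> by (intro mult_neg_pos) auto
    then have "eventually (\<lambda>t. B * sqrt t \<le> f t) (at_right 0)"
      using B by (intro eventually_ge_sqrt) auto
    with eventually_at_right_less[of 0] show "eventually (\<lambda>t. a < f t / sqrt t) (at_right 0)"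
    proof eventually_elim
      case (elim t)
      then have "B \<le> f t / sqrt t" by (simp add: pos_le_divide_eq)
      with B show ?case by simp
    qed
  next
    fix a assume "A < a"
    then obtain B where B: "A < B" "B < a" using dense by blast
    have "0 < B * (B - c) - 4"
      unfolding factor using B \<open>A' < 0\<close> \<open>A > 0\<close> by (intro mult_pos_pos) auto
    then have "eventually (\<lambda>t. f t \<le> B * sqrt t) (at_right 0)"
      using B \<open>A > 0\<close> by (intro eventually_le_sqrt) auto
    with eventually_at_right_less[of 0] show "eventually (\<lambda>t. f t / sqrt t < a) (at_right 0)"
    proof eventually_elim
      case (elim t)
      then have "f t / sqrt t \<le> B" by (simp add: pos_divide_le_eq)
      with B show ?case by simp
    qed
  qed
  then show ?thesis by (simp add: A_def)
qed

end

text \<open>The right-hand side \<open>2 / (x - y)\<close> is odd under a simultaneous sign change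
  of \<open>x\<close> and \<open>y\<close>.\<close>

lemma loewner_ode_uminus:
  assumes "loewner_ode \<xi> T f"
  shows "loewner_ode (\<lambda>t. - \<xi> t) T (\<lambda>t. - f t)"
  unfolding loewner_ode_def
proof
  fix t assume "t \<in> {0<..T}"
  then have ne: "f t \<noteq> \<xi> t"
    and "(f has_real_derivative 2 / (f t - \<xi> t)) (at t within {0..T})"
    using assms by (auto simp: loewner_ode_def)
  then have "((\<lambda>t. - f t) has_real_derivative - (2 / (f t - \<xi> t))) (at t within {0..T})"
    by (intro DERIV_minus)
  moreover have "- (2 / (f t - \<xi> t)) = 2 / (- f t - - \<xi> t)"
    using ne by (simp add: divide_simps)
  ultimately show "- f t \<noteq> - \<xi> t \<and>
      ((\<lambda>t. - f t) has_real_derivative 2 / (- f t - - \<xi> t)) (at t within {0..T})"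
    using ne by simp
qed

theorem theorem2:
  fixes c T :: real and \<xi> f1 f2 :: "real \<Rightarrow> real"
  assumes "continuous_on {0..} \<xi>"
    and "(\<lambda>t. \<xi> t - c * sqrt t) \<in> o[at_right 0](\<lambda>t. sqrt t)"
    and "T > 0"
    and "singular_solutions \<xi> T f1 f2"
  shows "((\<lambda>t. f1 t / sqrt t) \<longlongrightarrow> (c + sqrt (c\<^sup>2 + 16)) / 2) (at_right 0)
       \<and> ((\<lambda>t. f2 t / sqrt t) \<longlongrightarrow> (c - sqrt (c\<^sup>2 + 16)) / 2) (at_right 0)"
proof
  note sol = assms(4)[unfolded singular_solutions_def]
  show "((\<lambda>t. f1 t / sqrt t) \<longlongrightarrow> (c + sqrt (c\<^sup>2 + 16)) / 2) (at_right 0)"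
    using sol by (intro upper_solution_asymp[OF assms(2,3)]) auto
  have "(\<lambda>t. - (\<xi> t - c * sqrt t)) \<in> o[at_right 0](\<lambda>t. sqrt t)"
    using assms(2) by (simp only: landau_o.small.uminus_in_iff)
  then have "(\<lambda>t. - \<xi> t - (- c) * sqrt t) \<in> o[at_right 0](\<lambda>t. sqrt t)"
    by simp
  \<comment> \<open>The reflected trajectory \<open>- f2\<close> lies above \<open>- \<xi>\<close>,
    whose leading coefficient is \<open>- c\<close>.\<close>
  then have "((\<lambda>t. - f2 t / sqrt t) \<longlongrightarrow> (- c + sqrt ((- c)\<^sup>2 + 16)) / 2) (at_right 0)"
    using sol loewner_ode_uminus[of \<xi> T f2]
    by (intro upper_solution_asymp[OF _ assms(3)]) (auto intro: continuous_on_minus)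
  from tendsto_minus[OF this]
  have "((\<lambda>t. f2 t / sqrt t) \<longlongrightarrow> - ((- c + sqrt ((- c)\<^sup>2 + 16)) / 2)) (at_right 0)"
    by simp
  moreover have "- ((- c + sqrt ((- c)\<^sup>2 + 16)) / 2) = (c - sqrt (c\<^sup>2 + 16)) / 2"
    by (simp add: field_simps)
  ultimately show "((\<lambda>t. f2 t / sqrt t) \<longlongrightarrow> (c - sqrt (c\<^sup>2 + 16)) / 2) (at_right 0)"
    by (simp only:)
qed

end
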